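(* Let $\Delta$ be a positive integer, let $n$ be a positive integer, and let $G$ be a graph with minimum degree at least $10^7\Delta$ and maximum degree at most $\exp(\Delta/10^9)$ such that every subgraph of $G$ on at most $(10^7\Delta+1)n$ vertices has average degree at most $12/5$. Then $G$ contains every tree with maximum degree at most $\Delta$ on $n$ vertices as an induced subgraph. *)

theory Defs
  imports Complex_Main
begin

definition graph :: "'a set \<Rightarrow> ('a \<Rightarrow> 'a \<Rightarrow> bool) \<Rightarrow> bool" where
  "graph V E \<longleftrightarrow> finite V \<and> (\<forall>u v. E u v \<longrightarrow> u \<in> V \<and> v \<in> V \<and> u \<noteq> v \<and> E v u)"

definition degree :: "'a set \<Rightarrow> ('a \<Rightarrow> 'a \<Rightarrow> bool) \<Rightarrow> 'a \<Rightarrow> nat" where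
  "degree V E v = card {u \<in> V. E v u}"

definition subgraph :: "'a set \<Rightarrow> ('a \<Rightarrow> 'a \<Rightarrow> bool) \<Rightarrow> 'a set \<Rightarrow> ('a \<Rightarrow> 'a \<Rightarrow> bool) \<Rightarrow> bool" where
  "subgraph W F V E \<longleftrightarrow> W \<subseteq> V \<and> (\<forall>u v. F u v \<longrightarrow> u \<in> W \<and> v \<in> W \<and> E u v \<and> F v u)"

definition avg_degree :: "'a set \<Rightarrow> ('a \<Rightarrow> 'a \<Rightarrow> bool) \<Rightarrow> real" where
  "avg_degree W F = (\<Sum>v\<in>W. real (degree W F v)) / real (card W)"

definition connected_graph :: "'a set \<Rightarrow> ('a \<Rightarrow> 'a \<Rightarrow> bool) \<Rightarrow> bool" where
  "connected_graph V E \<longleftrightarrow> (\<forall>u\<in>V. \<forall>v\<in>V. (\<lambda>x y. E x y \<and> x \<in> V \<and> y \<in> V)\<^sup>*\<^sup>* u v)"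

definition is_cycle :: "('a \<Rightarrow> 'a \<Rightarrow> bool) \<Rightarrow> 'a list \<Rightarrow> bool" where
  "is_cycle E vs \<longleftrightarrow> length vs \<ge> 3 \<and> distinct vs \<and>
     (\<forall>i. Suc i < length vs \<longrightarrow> E (vs ! i) (vs ! Suc i)) \<and> E (last vs) (hd vs)"

definition acyclic_graph :: "'a set \<Rightarrow> ('a \<Rightarrow> 'a \<Rightarrow> bool) \<Rightarrow> bool" where
  "acyclic_graph V E \<longleftrightarrow> \<not> (\<exists>vs. set vs \<subseteq> V \<and> is_cycle E vs)"

definition tree :: "'a set \<Rightarrow> ('a \<Rightarrow> 'a \<Rightarrow> bool) \<Rightarrow> bool" where
  "tree V E \<longleftrightarrow> graph V E \<and> V \<noteq> {} \<and> connected_graph V E \<and> acyclic_graph V E"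

definition contains_induced :: "'a set \<Rightarrow> ('a \<Rightarrow> 'a \<Rightarrow> bool) \<Rightarrow> 'b set \<Rightarrow> ('b \<Rightarrow> 'b \<Rightarrow> bool) \<Rightarrow> bool" where
  "contains_induced V E VT ET \<longleftrightarrow> (\<exists>f. inj_on f VT \<and> f ` VT \<subseteq> V \<and>
      (\<forall>u\<in>VT. \<forall>v\<in>VT. ET u v \<longleftrightarrow> E (f u) (f v)))"

end

theory Submission
  imports Defs
begin

text \<open>
  The tree is embedded one vertex at a time, keeping a set \<open>A\<close> of active vertices that contains
  the current image, and for each \<open>u \<in> A\<close> a set \<open>R u\<close> of \<open>\<Delta>\<close> neighbours from which
  the children of \<open>u\<close> will be taken. Reserved vertices are never adjacent, except when one of
  them is the vertex for which the other is reserved, so the image remains induced. A vertex outside \<open>A\<close>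
  is endangered once at least \<open>s = 10\<^sup>6\<Delta>\<close> of its neighbours can be reached from \<open>A\<close>
  by a path of length at most 2 avoiding it. Endangered vertices are made active before they are
  needed. Average degree at most \<open>12/5 < 5/2\<close> bounds their number by the size of the image,
  and it also allows the sets \<open>R u\<close> to be chosen for all new active vertices at once, since
  many of their neighbours have degree 1 in the union of their neighbourhoods.
\<close>

section \<open>Growing a subtree of a tree by one vertex at a time\<close>

lemma rtranclp_imp_distinct_path:
  assumes "r\<^sup>*\<^sup>* u v"
  shows "\<exists>xs. xs \<noteq> [] \<and> hd xs = u \<and> last xs = v \<and> distinct xs \<and> successively r xs"
  using assms
proof (induction rule: rtranclp_induct)
  case base
  show ?case by (intro exI[of _ "[u]"]) simp
next
  case (step y z)
  then obtain xs where xs: "xs \<noteq> []" "hd xs = u" "last xs = y" "distinct xs" "successively r xs"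
    by blast
  show ?case
  \<comment> \<open>If the walk returns to a vertex already on the path, the path is cut at that
    vertex; otherwise it is prolonged.\<close>
  proof (cases "z \<in> set xs")
    case True
    then obtain as bs where "xs = as @ z # bs" by (meson split_list)
    then show ?thesis
      using xs by (intro exI[of _ "as @ [z]"])
        (auto simp: successively_append_iff hd_append split: if_splits)
  next
    case False
    then show ?thesis
      using xs step.hyps by (intro exI[of _ "xs @ [z]"]) (auto simp: successively_append_iff)
  qed
qed

text \<open>A path inside \<open>U\<close> joining two distinct neighbours of \<open>w\<close> would
  close up through \<open>w\<close> to a cycle.\<close>

lemma acyclic_unique_neighbour:
  assumes ac: "acyclic_graph V E" and sym: "\<And>u v. E u v \<Longrightarrow> E v u"
    and U: "U \<subseteq> V" "connected_graph U E" and w: "w \<in> V - U"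
    and uv: "u \<in> U" "v \<in> U" "E u w" "E v w"
  shows "u = v"
proof (rule ccontr)
  assume "u \<noteq> v"
  let ?r = "\<lambda>x y. E x y \<and> x \<in> U \<and> y \<in> U"
  have "?r\<^sup>*\<^sup>* u v" using U uv unfolding connected_graph_def by blast
  then obtain xs where xs: "xs \<noteq> []" "hd xs = u" "last xs = v" "distinct xs" "successively ?r xs"
    using rtranclp_imp_distinct_path[of ?r u v] by blast
  obtain a ys where ys: "xs = a # ys" using xs(1) by (cases xs) auto
  with xs \<open>u \<noteq> v\<close> have ne: "ys \<noteq> []" by auto
  have sub: "set xs \<subseteq> U"
  proof
    fix x assume "x \<in> set xs"
    then obtain i where i: "i < length xs" "x = xs ! i" by (metis in_set_conv_nth)
    have nth: "?r (xs ! j) (xs ! Suc j)" if "Suc j < length xs" for j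
      using xs(5) that by (simp add: successively_conv_nth)
    show "x \<in> U"
    proof (cases i)
      case 0
      then show ?thesis using i xs uv by (simp add: hd_conv_nth)
    next
      case (Suc j)
      then show ?thesis using nth[of j] i by simp
    qed
  qed
  have "successively E xs" using xs(5) by (rule successively_mono) auto
  then have "successively E (xs @ [w])" using xs uv by (simp add: successively_append_iff)
  moreover have "length (xs @ [w]) \<ge> 3" using ys ne by (cases ys) auto
  moreover have "E (last (xs @ [w])) (hd (xs @ [w]))" using xs uv sym by simp
  moreover have "distinct (xs @ [w])" using sub xs w by auto
  ultimately have "is_cycle E (xs @ [w])"
    unfolding is_cycle_def by (simp add: successively_conv_nth)
  moreover have "set (xs @ [w]) \<subseteq> V" using sub U w by auto
  ultimately show False using ac unfolding acyclic_graph_def by blast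
qed

lemma connected_graph_insert:
  assumes "connected_graph U E" "v \<in> U" "E v w" "E w v"
  shows "connected_graph (insert w U) E"
proof -
  let ?r = "\<lambda>x y. E x y \<and> x \<in> U \<and> y \<in> U"
  let ?r' = "\<lambda>x y. E x y \<and> x \<in> insert w U \<and> y \<in> insert w U"
  have U: "?r'\<^sup>*\<^sup>* x y" if "x \<in> U" "y \<in> U" for x y
  proof -
    have "?r\<^sup>*\<^sup>* x y" using assms that unfolding connected_graph_def by blast
    then show ?thesis by (rule rtranclp_mono[THEN predicate2D, rotated]) auto
  qed
  have "?r'\<^sup>*\<^sup>* x v \<and> ?r'\<^sup>*\<^sup>* v x" if "x \<in> insert w U" for x
    using that U[of x v] U[of v x] assms by auto
  then show ?thesis unfolding connected_graph_def by (meson rtranclp_trans)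
qed

text \<open>A path of the tree that starts in \<open>U\<close> and ends outside must cross an edge
  leaving \<open>U\<close>. Acyclicity turns the outer end of that edge into a new leaf.\<close>

lemma tree_extend_subtree:
  assumes T: "tree V E" and U: "U \<subseteq> V" "U \<noteq> {}" "U \<noteq> V" "connected_graph U E"
  obtains v w where "v \<in> U" "w \<in> V - U" "E v w" "\<And>u. u \<in> U \<Longrightarrow> E u w \<Longrightarrow> u = v"
    "connected_graph (insert w U) E"
proof -
  have sym: "\<And>u v. E u v \<Longrightarrow> E v u" and conn: "connected_graph V E" and ac: "acyclic_graph V E"
    using T unfolding tree_def graph_def by blast+
  obtain a b where ab: "a \<in> U" "b \<in> V - U" using U by blast
  then have "(\<lambda>x y. E x y \<and> x \<in> V \<and> y \<in> V)\<^sup>*\<^sup>* a b"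
    using conn U unfolding connected_graph_def by blast
  then have "b \<notin> U \<longrightarrow> (\<exists>v\<in>U. \<exists>w\<in>V - U. E v w)"
    by (induction rule: rtranclp_induct) (use ab in auto)
  then obtain v w where vw: "v \<in> U" "w \<in> V - U" "E v w" using ab by blast
  show thesis
  proof (rule that[OF vw])
    show "u = v" if "u \<in> U" "E u w" for u
      using acyclic_unique_neighbour[OF ac sym U(1,4) vw(2) that(1) vw(1) that(2) vw(3)] .
    show "connected_graph (insert w U) E"
      using connected_graph_insert[OF U(4) vw(1,3)] sym vw by blast
  qed
qed

section \<open>Endangered vertices in a sparse graph\<close>

text \<open>Sparsity is used for induced subgraphs only, with the fraction 12/5 cleared. The size
  bound fits \<open>2 * n\<close> vertices with \<open>s\<close> further ones each, and also
  \<open>n\<close> image vertices and \<open>n\<close> endangered ones with \<open>2 * s\<close>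
  further vertices for each of the latter. The two bounds on \<open>s\<close> are what the two
  degree counts below require, and degree \<open>2 * s\<close> leaves \<open>s\<close> neighbours
  after fewer than \<open>s\<close> are blocked.\<close>

locale sparse_graph =
  fixes V :: "'a set" and E :: "'a \<Rightarrow> 'a \<Rightarrow> bool" and s d n :: nat
  assumes graph: "graph V E"
    and s_large: "s \<ge> 25" "3 * s > 12 + 10 * d"
    and min_degree: "\<And>v. v \<in> V \<Longrightarrow> 2 * s \<le> card {u. E v u}"
    and sparse: "\<And>W. W \<subseteq> V \<Longrightarrow> W \<noteq> {} \<Longrightarrow> card W \<le> 2 * n * (s + 1) \<Longrightarrow>
      5 * (\<Sum>w\<in>W. card {u\<in>W. E w u}) \<le> 12 * card W"
begin

lemma finite_V: "finite V" and E_V: "E u v \<Longrightarrow> u \<in> V \<and> v \<in> V"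
  and E_neq: "E u v \<Longrightarrow> u \<noteq> v" and E_sym: "E u v \<Longrightarrow> E v u"
  using graph unfolding graph_def by blast+

text \<open>The witness \<open>z\<close> is the next vertex on a walk of length 1 or 2 from
  \<open>y\<close> to \<open>A\<close>. Length 2 is the right range: a neighbour reserved for
  \<open>x\<close> must be adjacent neither to \<open>A\<close> nor to a vertex reserved for a
  member of \<open>A\<close>, and the latter is itself adjacent to \<open>A\<close>.\<close>

definition blocked :: "'a set \<Rightarrow> 'a \<Rightarrow> 'a set" where
  "blocked A x = {y. E x y \<and> (\<exists>z. z \<noteq> x \<and> E y z \<and> (z \<in> A \<or> (\<exists>a\<in>A. E z a)))}"

text \<open>Each vertex outside \<open>S\<close> is endangered by all the others, not just by those
  added before it. In this form the order of addition is forgotten, and the property survives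
  enlarging both \<open>S\<close> and \<open>A\<close>.\<close>

definition supported :: "'a set \<Rightarrow> 'a set \<Rightarrow> bool" where
  "supported S A \<longleftrightarrow> S \<subseteq> A \<and> A \<subseteq> V \<and> (\<forall>q\<in>A - S. s \<le> card (blocked (A - {q}) q))"

definition saturated :: "'a set \<Rightarrow> bool" where
  "saturated A \<longleftrightarrow> A \<subseteq> V \<and> (\<forall>x\<in>V - A. card (blocked A x) < s)"

lemma finite_blocked: "finite (blocked A x)"
  by (rule finite_subset[OF _ finite_V]) (use E_V in \<open>auto simp: blocked_def\<close>)

lemma blocked_mono: "A \<subseteq> B \<Longrightarrow> blocked A x \<subseteq> blocked B x"
  unfolding blocked_def by blast

lemma card_blocked_mono: "A \<subseteq> B \<Longrightarrow> card (blocked A x) \<le> card (blocked B x)"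
  by (simp add: blocked_mono card_mono finite_blocked)

text \<open>
  Adjoin to \<open>A\<close>, for each \<open>q \<in> A - S\<close>, a set of \<open>s\<close> blocked neighbours together with witnesses.
  All new vertices have degree at least 2 in the resulting set, so the degree sum is too large.
\<close>
lemma card_supported_less:
  assumes sup: "supported S A" and S: "S \<noteq> {}" "card S \<le> n" and le: "card (A - S) \<le> card S"
  shows "card (A - S) < card S"
proof (rule ccontr)
  assume "\<not> ?thesis"
  then have m: "card (A - S) = card S" using le by simp
  define Q where "Q = A - S"
  have SA: "S \<subseteq> A" "A \<subseteq> V" using sup unfolding supported_def by auto
  have finA: "finite A" using SA(2) finite_V by (rule finite_subset)
  have fin: "finite A" "finite S" "finite Q"
    using finA finite_subset[OF SA(1)] unfolding Q_def by auto
  have "\<forall>q\<in>Q. \<exists>T. T \<subseteq> blocked (A - {q}) q \<and> card T = s"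
    using sup unfolding supported_def Q_def by (meson obtain_subset_with_card_n)
  then obtain T where T: "\<And>q. q \<in> Q \<Longrightarrow> T q \<subseteq> blocked (A - {q}) q" "\<And>q. q \<in> Q \<Longrightarrow> card (T q) = s"
    by metis
  have "\<forall>q\<in>Q. \<forall>y\<in>T q. \<exists>z. z \<noteq> q \<and> E y z \<and> (z \<in> A \<or> (\<exists>a\<in>A. E z a))"
    using T(1) unfolding blocked_def by blast
  then obtain z where z: "\<And>q y. q \<in> Q \<Longrightarrow> y \<in> T q \<Longrightarrow>
      z q y \<noteq> q \<and> E y (z q y) \<and> (z q y \<in> A \<or> (\<exists>a\<in>A. E (z q y) a))"
    by metis
  have TE: "E q y" if "q \<in> Q" "y \<in> T q" for q y
    using T(1) that unfolding blocked_def by blast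
  have finT: "finite (T q)" if "q \<in> Q" for q
    using T(1)[OF that] finite_blocked by (rule finite_subset)
  \<comment> \<open>A chosen neighbour already in \<open>A\<close> is not new and needs no second
    neighbour, so its witness is not added.\<close>
  define N where "N = (\<Union>q\<in>Q. T q \<union> z q ` (T q - A)) - A"
  define W where "W = A \<union> N"
  have cN: "card N \<le> 2 * s * card Q"
  proof -
    have "card N \<le> card (\<Union>q\<in>Q. T q \<union> z q ` (T q - A))"
      unfolding N_def using fin finT by (intro card_mono) auto
    also have "\<dots> \<le> (\<Sum>q\<in>Q. card (T q \<union> z q ` (T q - A)))"
      using fin by (intro card_UN_le)
    also have "\<dots> \<le> (\<Sum>q\<in>Q. 2 * s)"
    proof (intro sum_mono)
      fix q assume q: "q \<in> Q"
      have "card (T q \<union> z q ` (T q - A)) \<le> card (T q) + card (z q ` (T q - A))"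
        by (rule card_Un_le)
      also have "card (z q ` (T q - A)) \<le> card (T q)"
        using finT[OF q] by (meson card_image_le card_mono Diff_subset finite_Diff le_trans)
      finally show "card (T q \<union> z q ` (T q - A)) \<le> 2 * s" using T(2)[OF q] by simp
    qed
    finally show ?thesis by (simp add: mult.commute)
  qed
  have NV: "N \<subseteq> V" unfolding N_def using z E_V TE by blast
  then have finN: "finite N" using finite_V by (rule finite_subset)
  have WV: "W \<subseteq> V" and finW: "finite W" using SA NV finN finA unfolding W_def by auto
  have cA: "card A = 2 * card S"
    using m card_Diff_subset[OF fin(2) SA(1)] card_mono[OF fin(1) SA(1)] by simp
  have cW: "card W = card A + card N"
    unfolding W_def using fin finN by (intro card_Un_disjoint) (auto simp: N_def)
  have Qm: "card Q = card S" using m Q_def by simp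
  have "card W \<le> 2 * card S + 2 * s * card S" using cW cA cN Qm by simp
  also have "\<dots> = 2 * card S * (s + 1)" by (simp add: algebra_simps)
  also have "\<dots> \<le> 2 * n * (s + 1)" using S(2) by (intro mult_le_mono) auto
  finally have "card W \<le> 2 * n * (s + 1)" .
  moreover have "W \<noteq> {}" using S SA unfolding W_def by auto
  ultimately have up: "5 * (\<Sum>w\<in>W. card {u\<in>W. E w u}) \<le> 12 * card W"
    using sparse[OF WV] by blast
  have degQ: "s \<le> card {u\<in>W. E q u}" if q: "q \<in> Q" for q
  proof -
    have "T q \<subseteq> {u\<in>W. E q u}" using q TE unfolding W_def N_def by blast
    then show ?thesis using T(2)[OF q] finW card_mono[of "{u\<in>W. E q u}" "T q"] by simp
  qed
  have two: "2 \<le> card {u\<in>W. E w u}" if "b \<in> W" "c \<in> W" "b \<noteq> c" "E w b" "E w c" for w b c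
  proof -
    have "card {b, c} \<le> card {u\<in>W. E w u}" using that finW by (intro card_mono) auto
    then show ?thesis using that by simp
  qed
  have degN: "2 \<le> card {u\<in>W. E w u}" if w: "w \<in> N" for w
  proof -
    obtain q where q: "q \<in> Q" "w \<in> T q \<or> w \<in> z q ` (T q - A)" "w \<notin> A"
      using w unfolding N_def by blast
    have qA: "q \<in> A" using q Q_def by blast
    show ?thesis
    proof (cases "w \<in> T q")
      case True
      have "z q w \<in> W" using True q unfolding W_def N_def by blast
      moreover have "q \<in> W" using qA W_def by blast
      moreover have "E w q" using TE[OF q(1) True] by (rule E_sym)
      ultimately show ?thesis using z[OF q(1) True] two[of q "z q w"] by auto
    next
      case False
      then obtain y where y: "y \<in> T q" "y \<notin> A" "w = z q y" using q by blast
      \<comment> \<open>As \<open>w\<close> is a witness outside \<open>A\<close>, it must be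
        adjacent to some \<open>a\<close> in \<open>A\<close>; its other neighbour \<open>y\<close>
        lies outside \<open>A\<close>.\<close>
      then obtain a where a: "a \<in> A" "E w a" using z[OF q(1) y(1)] q by blast
      have "y \<in> W" using y q unfolding W_def N_def by blast
      moreover have "a \<in> W" using a W_def by blast
      moreover have "E w y" using z[OF q(1) y(1)] y E_sym by blast
      moreover have "a \<noteq> y" using a y by blast
      ultimately show ?thesis using two[of a y w] a by blast
    qed
  qed
  have "s * card Q + 2 * card N = (\<Sum>w\<in>Q. s) + (\<Sum>w\<in>N. 2)" by simp
  also have "\<dots> \<le> (\<Sum>w\<in>Q. card {u\<in>W. E w u}) + (\<Sum>w\<in>N. card {u\<in>W. E w u})"
    using degQ degN by (intro add_mono sum_mono)
  also have "\<dots> = (\<Sum>w\<in>Q \<union> N. card {u\<in>W. E w u})"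
    using fin finN by (intro sum.union_disjoint[symmetric]) (auto simp: N_def Q_def)
  also have "\<dots> \<le> (\<Sum>w\<in>W. card {u\<in>W. E w u})"
    using finW by (intro sum_mono2) (auto simp: W_def Q_def)
  finally have low: "s * card Q + 2 * card N \<le> (\<Sum>w\<in>W. card {u\<in>W. E w u})" .
  \<comment> \<open>Here 24 is 12 times the two halves of \<open>A\<close>. The excess of 12 over 10
    costs \<open>2 * card N\<close>, at most \<open>4 * s * card S\<close>, so one
    \<open>s * card S\<close> survives and \<open>s\<close> would be at most 24.\<close>
  have "5 * (s * card S) + 10 * card N \<le> 24 * card S + 12 * card N"
    using low up cW cA Qm by simp
  moreover have "card N \<le> 2 * (s * card S)" using cN Qm by simp
  ultimately have "s * card S \<le> 24 * card S" by linarith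
  moreover have "card S > 0" using S fin by (simp add: card_gt_0_iff)
  ultimately show False using s_large by simp
qed

lemma supported_insert:
  assumes "supported S A" "x \<in> V - A" "s \<le> card (blocked A x)"
  shows "supported S (insert x A)"
proof -
  have "s \<le> card (blocked (insert x A - {q}) q)" if q: "q \<in> insert x A - S" for q
  proof (cases "q = x")
    case True
    then have "insert x A - {q} = A" using assms by auto
    then show ?thesis using assms True by simp
  next
    case False
    then have "s \<le> card (blocked (A - {q}) q)" using assms q unfolding supported_def by blast
    also have "\<dots> \<le> card (blocked (insert x A - {q}) q)" by (rule card_blocked_mono) blast
    finally show ?thesis .
  qed
  then show ?thesis using assms unfolding supported_def by blast
qed

text \<open>Take a maximal supported superset with at most \<open>card S\<close> extra vertices. By
  the strict bound there is room for one more, so an endangered vertex left outside would contradict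
  maximality.\<close>

lemma saturated_supported_superset:
  assumes A: "supported S A" "card (A - S) \<le> card S" and S: "S \<noteq> {}" "card S \<le> n"
  obtains B where "A \<subseteq> B" "supported S B" "saturated B" "card (B - S) < card S"
proof -
  define \<B> where "\<B> = {B. A \<subseteq> B \<and> supported S B \<and> card (B - S) \<le> card S}"
  have "\<B> \<subseteq> Pow V" unfolding \<B>_def supported_def by blast
  then have "finite \<B>" using finite_V finite_subset by blast
  moreover have "A \<in> \<B>" using A unfolding \<B>_def by simp
  ultimately obtain B where B: "B \<in> \<B>" and max: "\<And>C. C \<in> \<B> \<Longrightarrow> B \<subseteq> C \<Longrightarrow> B = C"
    using finite_has_maximal2[of \<B> A] by metis
  have sup: "A \<subseteq> B" "supported S B" "card (B - S) \<le> card S" using B unfolding \<B>_def by auto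
  have less: "card (B - S) < card S" using card_supported_less sup S by blast
  have BV: "S \<subseteq> B" "B \<subseteq> V" using sup unfolding supported_def by auto
  have "card (blocked B x) < s" if x: "x \<in> V - B" for x
  proof (rule ccontr)
    assume "\<not> ?thesis"
    then have "supported S (insert x B)" using supported_insert[OF sup(2) x] by simp
    moreover have "card (insert x B - S) \<le> card S"
    proof -
      have "insert x B - S = insert x (B - S)" using x BV by auto
      then show ?thesis using less card_insert_le_m1[of "card S" "B - S" x] S
        by simp
    qed
    ultimately have "insert x B \<in> \<B>" using sup unfolding \<B>_def by blast
    then show False using max[of "insert x B"] x by blast
  qed
  then have "saturated B" using BV unfolding saturated_def by blast
  then show thesis using that sup less by blast
qed

text \<open>The saturated superset of a singleton has fewer than one extra vertex, so it is the
  singleton itself.\<close>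

lemma saturated_singleton:
  assumes "v \<in> V" "n \<ge> 1"
  shows "saturated {v}" "supported {v} {v}"
proof -
  show sup: "supported {v} {v}" using assms unfolding supported_def by simp
  obtain B where B: "{v} \<subseteq> B" "supported {v} B" "saturated B" "card (B - {v}) < card {v}"
    using saturated_supported_superset[OF sup] assms by auto
  have "finite (B - {v})"
    using B(2) finite_subset[OF _ finite_V, of B] unfolding supported_def by simp
  moreover have "card (B - {v}) = 0" using B(4) by simp
  ultimately have "B - {v} = {}" by (simp only: card_0_eq)
  then have "B = {v}" using B(1) by blast
  then show "saturated {v}" using B(3) by simp
qed

section \<open>Reserving neighbours for many active vertices at once\<close>

text \<open>
  The vertices found here are compatible with every choice for the remaining vertices of \<open>P\<close>,
  so \<open>x\<close> can be peeled off.
\<close>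
lemma exists_private_neighbours:
  assumes P: "P \<subseteq> V" "P \<noteq> {}" "card P \<le> 2 * n"
    and F: "\<And>x. x \<in> P \<Longrightarrow> F x \<subseteq> {y. E x y}" "\<And>x. x \<in> P \<Longrightarrow> card (F x) = s"
  shows "\<exists>x\<in>P. d \<le> card {y\<in>F x. \<forall>u\<in>P \<union> \<Union>(F ` P). E y u \<longrightarrow> u = x}"
proof (rule ccontr)
  define W where "W = P \<union> \<Union>(F ` P)"
  define G where "G x = {y\<in>F x. \<forall>u\<in>W. E y u \<longrightarrow> u = x}" for x
  assume "\<not> ?thesis"
  then have few: "card (G x) \<le> d" if "x \<in> P" for x
    using that unfolding G_def W_def by fastforce
  have WV: "W \<subseteq> V" unfolding W_def using P F E_V by blast
  have fin: "finite W" "finite P" using finite_subset[OF WV finite_V] unfolding W_def by auto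
  have finF: "finite (F x)" if "x \<in> P" for x
    using fin that unfolding W_def by (meson UN_upper Un_upper2 finite_subset)
  define N where "N = W - P"
  have finN: "finite N" using fin N_def by simp
  have cW: "card W = card P + card N"
    unfolding N_def using fin by (simp add: W_def card_Diff_subset card_mono)
  have "card N \<le> card (\<Union>(F ` P))"
    unfolding N_def W_def using fin finF by (intro card_mono) auto
  also have "\<dots> \<le> (\<Sum>x\<in>P. card (F x))" using fin(2) by (rule card_UN_le)
  finally have cN: "card N \<le> s * card P" using F(2) by (simp add: mult.commute)
  have "card W \<le> card P * (s + 1)" using cW cN by (simp add: algebra_simps)
  also have "\<dots> \<le> 2 * n * (s + 1)" using P by (intro mult_le_mono) auto
  finally have up: "5 * (\<Sum>w\<in>W. card {u\<in>W. E w u}) \<le> 12 * card W"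
    using sparse[OF WV] P W_def by blast
  \<comment> \<open>\<open>H\<close> collects the private neighbours. Every vertex of
    \<open>N\<close> outside \<open>H\<close> has two neighbours in \<open>W\<close>; the degrees in
    \<open>H\<close> are simply discarded, at a cost of 2 each.\<close>
  define H where "H = \<Union>(G ` P)"
  have "card H \<le> (\<Sum>x\<in>P. card (G x))" unfolding H_def using fin(2) by (rule card_UN_le)
  also have "\<dots> \<le> (\<Sum>x\<in>P. d)" using few by (rule sum_mono)
  finally have cH: "card H \<le> d * card P" by (simp add: mult.commute)
  have degP: "s \<le> card {u\<in>W. E x u}" if x: "x \<in> P" for x
  proof -
    have "F x \<subseteq> {u\<in>W. E x u}" using x F unfolding W_def by blast
    then show ?thesis using F(2)[OF x] fin card_mono[of "{u\<in>W. E x u}" "F x"] by simp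
  qed
  have degN: "2 \<le> card {u\<in>W. E y u}" if y: "y \<in> N - H" for y
  proof -
    obtain x where x: "x \<in> P" "y \<in> F x" using y unfolding N_def W_def by blast
    then obtain u where u: "u \<in> W" "E y u" "u \<noteq> x" using y unfolding H_def G_def by blast
    have "{x, u} \<subseteq> {u\<in>W. E y u}" using x u F E_sym unfolding W_def by blast
    then have "card {x, u} \<le> card {u\<in>W. E y u}" using fin by (intro card_mono) auto
    then show ?thesis using u by simp
  qed
  have finH: "finite H" unfolding H_def G_def using fin finF by auto
  have "card N \<le> card (N - H) + card H"
    using finH diff_card_le_card_Diff[of H N] by simp
  then have "s * card P + 2 * card N \<le> (\<Sum>x\<in>P. s) + (\<Sum>y\<in>N - H. 2) + 2 * card H" by simp
  also have "\<dots> \<le> (\<Sum>w\<in>P. card {u\<in>W. E w u}) + (\<Sum>w\<in>N - H. card {u\<in>W. E w u}) + 2 * card H"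
    using degP degN by (intro add_mono sum_mono) auto
  also have "(\<Sum>w\<in>P. card {u\<in>W. E w u}) + (\<Sum>w\<in>N - H. card {u\<in>W. E w u})
      = (\<Sum>w\<in>P \<union> (N - H). card {u\<in>W. E w u})"
    using fin finN by (intro sum.union_disjoint[symmetric]) (auto simp: N_def)
  also have "\<dots> \<le> (\<Sum>w\<in>W. card {u\<in>W. E w u})"
    using fin by (intro sum_mono2) (auto simp: W_def N_def)
  finally have "s * card P + 2 * card N \<le> (\<Sum>w\<in>W. card {u\<in>W. E w u}) + 2 * card H" by simp
  \<comment> \<open>The bound \<open>card N\<close> \<le> \<open>s * card P\<close> absorbs two of
    the five copies of \<open>s * card P\<close>, which explains the form of the condition
    \<open>3 * s > 12 + 10 * d\<close>.\<close>
  then have "5 * (s * card P) \<le> 12 * card P + 2 * card N + 10 * card H"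
    using up cW by simp
  then have "3 * (s * card P) \<le> 12 * card P + 10 * (d * card P)" using cN cH by linarith
  then have "(3 * s) * card P \<le> (12 + 10 * d) * card P" by (simp add: algebra_simps)
  moreover have "card P > 0" using P fin by (simp add: card_gt_0_iff)
  ultimately show False using s_large by simp
qed

text \<open>The exceptions are unavoidable: a reserved vertex chosen as an image becomes active, and
  the vertices then reserved for it are adjacent to it. The case \<open>u = v\<close> is
  included.\<close>

definition reserved :: "'a set \<Rightarrow> ('a \<Rightarrow> 'a set) \<Rightarrow> bool" where
  "reserved A R \<longleftrightarrow> (\<forall>u\<in>A. R u \<subseteq> {y. E u y} \<and> d \<le> card (R u)) \<and>
     (\<forall>u\<in>A. \<forall>v\<in>A. \<forall>r\<in>R u. \<forall>r'\<in>R v. E r r' \<longrightarrow> r = v \<or> r' = u)"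

lemma exists_reserved:
  assumes "P \<subseteq> V" "card P \<le> 2 * n"
    and F: "\<And>x. x \<in> P \<Longrightarrow> F x \<subseteq> {y. E x y}" "\<And>x. x \<in> P \<Longrightarrow> card (F x) = s"
  shows "\<exists>R. reserved P R \<and> (\<forall>x\<in>P. R x \<subseteq> F x)"
proof -
  have "finite P" using assms finite_V finite_subset by blast
  then show ?thesis using assms
  proof (induction P rule: finite_psubset_induct)
    case (psubset P)
    show ?case
    proof (cases "P = {}")
      case True
      then show ?thesis unfolding reserved_def by simp
    next
      case False
      define G where "G x = {y\<in>F x. \<forall>u\<in>P \<union> \<Union>(F ` P). E y u \<longrightarrow> u = x}" for x
      obtain x where x: "x \<in> P" "d \<le> card (G x)"
        unfolding G_def
        using exists_private_neighbours[OF psubset.prems(1) False psubset.prems(2-4)] by blast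
      have "\<exists>R. reserved (P - {x}) R \<and> (\<forall>y\<in>P - {x}. R y \<subseteq> F y)"
      proof (rule psubset.IH)
        show "P - {x} \<subset> P" using x by blast
        show "card (P - {x}) \<le> 2 * n"
          using psubset.prems(2) psubset.hyps by (meson Diff_subset card_mono le_trans)
      qed (use psubset.prems in auto)
      then obtain R where R: "reserved (P - {x}) R" "\<And>y. y \<in> P - {x} \<Longrightarrow> R y \<subseteq> F y" by blast
      define R' where "R' = R(x := G x)"
      have R'F: "R' y \<subseteq> F y" if "y \<in> P" for y
        using R(2) that unfolding R'_def G_def by auto
      \<comment> \<open>All other choices lie in the sets \<open>F v\<close>, where a private
        neighbour of \<open>x\<close> sees nothing but possibly \<open>x\<close> itself. This is
        exactly the permitted exception.\<close>
      have G: "r' = x" if "r \<in> G x" "v \<in> P" "r' \<in> R' v" "E r r'" for r r' v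
        using that R'F unfolding G_def by blast
      have "r = v \<or> r' = u" if H: "u \<in> P" "v \<in> P" "r \<in> R' u" "r' \<in> R' v" "E r r'" for u v r r'
      proof -
        consider "u = x" | "v = x" | "u \<noteq> x" "v \<noteq> x" by blast
        then show ?thesis
        proof cases
          case 1
          then show ?thesis using G[of r v r'] H unfolding R'_def by auto
        next
          case 2
          then show ?thesis using G[of r' u r] H E_sym unfolding R'_def by auto
        next
          case 3
          then show ?thesis using R(1) H unfolding R'_def reserved_def by auto
        qed
      qed
      moreover have "R' u \<subseteq> {y. E u y} \<and> d \<le> card (R' u)" if "u \<in> P" for u
        using that R'F[OF that] psubset.prems(3)[OF that] x(2) R(1)
        unfolding R'_def reserved_def by auto
      ultimately have "reserved P R'" unfolding reserved_def by blast
      then show ?thesis using R'F by blast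
    qed
  qed
qed

text \<open>Since \<open>A\<close> is saturated, every new vertex keeps \<open>s\<close> unblocked
  neighbours. Choosing among these avoids conflicts with \<open>A\<close> and with everything
  reserved for \<open>A\<close>, so old reservations stay unchanged.\<close>

lemma reserved_extend:
  assumes R: "reserved A R" and A: "saturated A" and B: "A \<subseteq> B" "B \<subseteq> V" "card B \<le> 2 * n"
  obtains R' where "reserved B R'" "\<And>u. u \<in> A \<Longrightarrow> R' u = R u"
    "\<And>u r a. u \<in> B - A \<Longrightarrow> r \<in> R' u \<Longrightarrow> a \<in> A \<Longrightarrow> \<not> E r a"
proof -
  have "\<exists>T. T \<subseteq> {y. E x y} - blocked A x \<and> card T = s" if x: "x \<in> B - A" for x
  proof -
    have "x \<in> V" "card (blocked A x) < s" using x A B unfolding saturated_def by blast+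
    then have "s \<le> card {y. E x y} - card (blocked A x)" using min_degree[of x] by simp
    also have "\<dots> \<le> card ({y. E x y} - blocked A x)"
      by (rule diff_card_le_card_Diff[OF finite_blocked])
    finally show ?thesis by (meson obtain_subset_with_card_n)
  qed
  then obtain F where F: "\<And>x. x \<in> B - A \<Longrightarrow> F x \<subseteq> {y. E x y} - blocked A x"
      "\<And>x. x \<in> B - A \<Longrightarrow> card (F x) = s"
    by metis
  have "card (B - A) \<le> 2 * n"
    using B finite_V by (meson Diff_subset card_mono finite_subset le_trans)
  then obtain R0 where R0: "reserved (B - A) R0" "\<And>x. x \<in> B - A \<Longrightarrow> R0 x \<subseteq> F x"
    using exists_reserved[of "B - A" F] F B by blast
  define R' where "R' u = (if u \<in> A then R u else R0 u)" for u
  have free: "z = x" if "x \<in> B - A" "r \<in> R' x" "E r z" "z \<in> A \<or> (\<exists>a\<in>A. E z a)" for x r z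
    using that F(1)[of x] R0(2)[of x] unfolding R'_def blocked_def by auto
  \<comment> \<open>The old reserved vertex \<open>r'\<close> is adjacent to \<open>u\<close> in
    \<open>A\<close>, so \<open>free\<close> applies to it.\<close>
  have mixed: "r' = x" if "x \<in> B - A" "r \<in> R' x" "u \<in> A" "r' \<in> R' u" "E r r'" for x r u r'
  proof -
    have "E r' u" using that R E_sym unfolding R'_def reserved_def by auto
    then show ?thesis using free[of x r r'] that by blast
  qed
  have "r = v \<or> r' = u" if H: "u \<in> B" "v \<in> B" "r \<in> R' u" "r' \<in> R' v" "E r r'" for u v r r'
  proof -
    consider "u \<in> A" "v \<in> A" | "u \<in> A" "v \<notin> A" | "u \<notin> A" "v \<in> A" | "u \<notin> A" "v \<notin> A" by blast
    then show ?thesis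
    proof cases
      case 1
      then show ?thesis using R H unfolding R'_def reserved_def by auto
    next
      case 2
      then show ?thesis using mixed[of v r' u r] H E_sym by blast
    next
      case 3
      then show ?thesis using mixed[of u r v r'] H by blast
    next
      case 4
      then show ?thesis using R0(1) H unfolding R'_def reserved_def by auto
    qed
  qed
  moreover have "R' u \<subseteq> {y. E u y} \<and> d \<le> card (R' u)" if "u \<in> B" for u
    using that R R0(1) unfolding R'_def reserved_def by auto
  ultimately have "reserved B R'" unfolding reserved_def by blast
  moreover have "\<not> E r a" if "u \<in> B - A" "r \<in> R' u" "a \<in> A" for u r a
    using free[of u r a] that by blast
  ultimately show thesis using that[of R'] unfolding R'_def by auto
qed

section \<open>Partial embeddings of the tree\<close>

text \<open>The cardinality clause keeps \<open>A\<close> below twice the size of the image. Every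
  image vertex except that of the root \<rho> was taken from a reserved set and is controlled by
  \<open>reserved\<close>; the root has a clause of its own.\<close>

definition partial_embedding ::
    "('b \<Rightarrow> 'b \<Rightarrow> bool) \<Rightarrow> 'b \<Rightarrow> 'b set \<Rightarrow> ('b \<Rightarrow> 'a) \<Rightarrow> 'a set \<Rightarrow> ('a \<Rightarrow> 'a set) \<Rightarrow> bool" where
  "partial_embedding ET \<rho> U f A R \<longleftrightarrow>
     \<rho> \<in> U \<and> connected_graph U ET \<and> inj_on f U \<and>
     (\<forall>u\<in>U. \<forall>v\<in>U. ET u v \<longleftrightarrow> E (f u) (f v)) \<and>
     supported (f ` U) A \<and> card (A - f ` U) < card U \<and> saturated A \<and> reserved A R \<and>
     (\<forall>u\<in>A. \<forall>r\<in>R u. E r (f \<rho>) \<longrightarrow> u = f \<rho>) \<and>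
     (\<forall>u\<in>U - {\<rho>}. \<exists>p\<in>U. f u \<in> R (f p))"

lemma partial_embedding_root:
  assumes "v \<in> V" "n \<ge> 1" "graph VT ET"
  shows "\<exists>R. partial_embedding ET \<rho> {\<rho>} (\<lambda>_. v) {v} R"
proof -
  \<comment> \<open>Nothing is blocked by the empty set, so the first reservation is an instance of
    the extension lemma.\<close>
  have "saturated {}" using s_large unfolding saturated_def blocked_def by simp
  moreover have "reserved {} R" for R unfolding reserved_def by simp
  ultimately obtain R where "reserved {v} R"
    using reserved_extend[of "{}" _ "{v}"] assms by auto
  moreover have "connected_graph {\<rho>} ET" unfolding connected_graph_def by simp
  moreover have "\<not> ET \<rho> \<rho>" "\<not> E v v" using assms E_neq unfolding graph_def by blast+
  ultimately have "partial_embedding ET \<rho> {\<rho>} (\<lambda>_. v) {v} R"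
    using saturated_singleton[OF assms(1,2)] unfolding partial_embedding_def by simp
  then show ?thesis by blast
qed

text \<open>Image vertices in \<open>R (f v)\<close> come from embedded neighbours of
  \<open>v\<close>, and \<open>w\<close> is not yet embedded, so some reserved \<open>x\<close> is
  free. If \<open>x\<close> were adjacent to another non-root image \<open>f u\<close>, reserved for
  \<open>f p\<close>, then \<open>reserved\<close> would force \<open>x = f p\<close>, although
  \<open>x\<close> is not in the image.\<close>

lemma partial_embedding_free_child:
  assumes pe: "partial_embedding ET \<rho> U f A R" and T: "graph VT ET" and U: "U \<subseteq> VT"
    and v: "v \<in> U" and w: "w \<in> VT - U" "ET v w" and deg: "degree VT ET v \<le> d"
  obtains x where "x \<in> R (f v)" "x \<notin> f ` U" "\<And>u. u \<in> U \<Longrightarrow> E (f u) x \<Longrightarrow> u = v"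
proof -
  have emb: "\<And>u v. u \<in> U \<Longrightarrow> v \<in> U \<Longrightarrow> ET u v \<longleftrightarrow> E (f u) (f v)"
    and sup: "supported (f ` U) A" and res: "reserved A R"
    and rt: "\<And>u r. u \<in> A \<Longrightarrow> r \<in> R u \<Longrightarrow> E r (f \<rho>) \<Longrightarrow> u = f \<rho>"
    and par: "\<And>u. u \<in> U - {\<rho>} \<Longrightarrow> \<exists>p\<in>U. f u \<in> R (f p)"
    and inj: "inj_on f U" and \<rho>: "\<rho> \<in> U"
    using pe unfolding partial_embedding_def by blast+
  have fA: "f u \<in> A" if "u \<in> U" for u using sup that unfolding supported_def by blast
  have Rv: "R (f v) \<subseteq> {y. E (f v) y}" "d \<le> card (R (f v))"
    using res fA[OF v] unfolding reserved_def by blast+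
  have finT: "finite VT" using T unfolding graph_def by blast
  have "\<not> R (f v) \<subseteq> f ` U"
  proof
    assume sub: "R (f v) \<subseteq> f ` U"
    have "R (f v) \<subseteq> f ` {u \<in> U. ET v u}"
    proof
      fix y assume "y \<in> R (f v)"
      moreover from this obtain u where "u \<in> U" "y = f u" using sub by blast
      ultimately show "y \<in> f ` {u \<in> U. ET v u}" using Rv emb[OF v] by blast
    qed
    then have "card (R (f v)) \<le> card {u \<in> U. ET v u}"
      using finT U by (intro surj_card_le) (auto intro: finite_subset)
    also have "\<dots> < card {u \<in> VT. ET v u}"
      using finT U w by (intro psubset_card_mono) auto
    finally show False using Rv deg unfolding degree_def by simp
  qed
  then obtain x where x: "x \<in> R (f v)" "x \<notin> f ` U" by blast
  moreover have "u = v" if u: "u \<in> U" "E (f u) x" for u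
  proof (cases "u = \<rho>")
    case True
    then have "f v = f \<rho>" using rt[OF fA[OF v] x(1)] u E_sym by blast
    then show ?thesis using inj \<rho> v True by (simp add: inj_on_eq_iff)
  next
    case False
    then obtain p where p: "p \<in> U" "f u \<in> R (f p)" using par u by blast
    have "f u = f v \<or> x = f p"
      using res fA[OF p(1)] fA[OF v] p x u unfolding reserved_def by blast
    then have "f u = f v" using x p by blast
    then show ?thesis using inj u v by (simp add: inj_on_eq_iff)
  qed
  ultimately show thesis using that by blast
qed

lemma partial_embedding_extend:
  assumes pe: "partial_embedding ET \<rho> U f A R" and T: "tree VT ET"
    and U: "U \<subseteq> VT" "U \<noteq> VT" and card: "card VT \<le> n"
    and deg: "\<And>v. v \<in> VT \<Longrightarrow> degree VT ET v \<le> d"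
  shows "\<exists>w\<in>VT - U. \<exists>f A R. partial_embedding ET \<rho> (insert w U) f A R"
proof -
  have emb: "\<And>u v. u \<in> U \<Longrightarrow> v \<in> U \<Longrightarrow> ET u v \<longleftrightarrow> E (f u) (f v)"
    and sup: "supported (f ` U) A" and res: "reserved A R" and sat: "saturated A"
    and rt: "\<And>u r. u \<in> A \<Longrightarrow> r \<in> R u \<Longrightarrow> E r (f \<rho>) \<Longrightarrow> u = f \<rho>"
    and par: "\<And>u. u \<in> U - {\<rho>} \<Longrightarrow> \<exists>p\<in>U. f u \<in> R (f p)"
    and inj: "inj_on f U" and \<rho>: "\<rho> \<in> U" and cA: "card (A - f ` U) < card U"
    and conn: "connected_graph U ET"
    using pe unfolding partial_embedding_def by blast+
  have TG: "graph VT ET" using T unfolding tree_def by blast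
  have Tsym: "ET a b \<Longrightarrow> ET b a" and Tirr: "\<not> ET a a" and finT: "finite VT" for a b
    using TG unfolding graph_def by blast+
  have finU: "finite U" using finT U finite_subset by blast
  obtain v w where vw: "v \<in> U" "w \<in> VT - U" "ET v w" "\<And>u. u \<in> U \<Longrightarrow> ET u w \<Longrightarrow> u = v"
      and conn': "connected_graph (insert w U) ET"
    using tree_extend_subtree[OF T U(1) _ U(2) conn] \<rho> by blast
  obtain x where x: "x \<in> R (f v)" "x \<notin> f ` U" "\<And>u. u \<in> U \<Longrightarrow> E (f u) x \<Longrightarrow> u = v"
    using partial_embedding_free_child[OF pe TG U(1) vw(1,2,3)] deg vw U by blast
  have fA: "f ` U \<subseteq> A" "A \<subseteq> V" using sup unfolding supported_def by blast+
  have vx: "E (f v) x" using res fA vw(1) x(1) unfolding reserved_def by blast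
  define f' where "f' = f(w := x)"
  have f'U: "f' u = f u" if "u \<in> U" for u using that vw(2) unfolding f'_def by auto
  have f'w: "f' w = x" unfolding f'_def by simp
  have im: "f' ` insert w U = insert x (f ` U)" using f'U f'w by auto
  have c': "card (insert w U) = Suc (card U)" using vw finU by simp
  have cS: "card (insert x (f ` U)) = Suc (card U)"
    using x finU card_image[OF inj] by simp
  have cn: "Suc (card U) \<le> n"
  proof -
    have "insert w U \<subseteq> VT" using U vw by blast
    then show ?thesis using card_mono[OF finT, of "insert w U"] c' card by simp
  qed
  have finA: "finite A" using fA finite_V finite_subset by blast
  \<comment> \<open>As part of the image, \<open>x\<close> needs no support, and the support of the
    others can only grow. It may already have been active.\<close>
  have sup1: "supported (insert x (f ` U)) (insert x A)"
  proof -
    have "s \<le> card (blocked (insert x A - {q}) q)" if q: "q \<in> A - f ` U" for q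
    proof -
      have "s \<le> card (blocked (A - {q}) q)" using sup q unfolding supported_def by blast
      also have "\<dots> \<le> card (blocked (insert x A - {q}) q)" by (rule card_blocked_mono) blast
      finally show ?thesis .
    qed
    then show ?thesis using fA vx E_V unfolding supported_def by blast
  qed
  have "card (insert x A - insert x (f ` U)) \<le> card (A - f ` U)"
    using finA by (intro card_mono) auto
  then obtain B where B: "insert x A \<subseteq> B" "supported (insert x (f ` U)) B" "saturated B"
      "card (B - insert x (f ` U)) < card (insert x (f ` U))"
    using saturated_supported_superset[OF sup1] cA cS cn by auto
  have BV: "B \<subseteq> V" using B(3) unfolding saturated_def by blast
  have "card B \<le> card (B - insert x (f ` U)) + card (insert x (f ` U))"
    using diff_card_le_card_Diff[of "insert x (f ` U)" B] finU by simp
  then have "card B \<le> 2 * n" using B(4) cS cn by simp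
  \<comment> \<open>The extension starts from the saturated set \<open>A\<close>, so
    \<open>x\<close>, if not yet active, receives its reservation together with the newly endangered
    vertices.\<close>
  then obtain R' where R': "reserved B R'" "\<And>u. u \<in> A \<Longrightarrow> R' u = R u"
      "\<And>u r a. u \<in> B - A \<Longrightarrow> r \<in> R' u \<Longrightarrow> a \<in> A \<Longrightarrow> \<not> E r a"
    using reserved_extend[OF res sat _ BV] B(1) by blast
  have "inj_on f' (insert w U)"
  proof -
    have "inj_on f' U" using inj f'U by (simp add: inj_on_def)
    moreover have "f' w \<notin> f' ` (U - {w})" using x(2) f'w f'U by auto
    ultimately show ?thesis by (simp add: inj_on_insert)
  qed
  moreover have "ET a b \<longleftrightarrow> E (f' a) (f' b)" if "a \<in> insert w U" "b \<in> insert w U" for a b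
  proof -
    have new: "ET u w \<longleftrightarrow> E (f u) x" if "u \<in> U" for u using vw x(3) vx that by blast
    have flip: "ET w u \<longleftrightarrow> ET u w" "E x (f u) \<longleftrightarrow> E (f u) x" for u using Tsym E_sym by blast+
    have irr: "\<not> E x x" using E_neq by blast
    show ?thesis using that emb f'U f'w new flip Tirr irr by auto
  qed
  \<comment> \<open>Old active vertices inherit this clause; vertices reserved for new ones are not
    adjacent to \<open>A\<close>, which contains the root image.\<close>
  moreover have "u = f' \<rho>" if "u \<in> B" "r \<in> R' u" "E r (f' \<rho>)" for u r
    using that R' rt fA \<rho> f'U[OF \<rho>] by (cases "u \<in> A") auto
  moreover have "\<exists>p\<in>insert w U. f' u \<in> R' (f' p)" if u: "u \<in> insert w U - {\<rho>}" for u
  proof (cases "u = w")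
    case True
    then have "f' u \<in> R' (f' v)" using f'w f'U vw(1) R'(2) fA x(1) by auto
    then show ?thesis using vw(1) by blast
  next
    case False
    then have uU: "u \<in> U - {\<rho>}" using u by blast
    then obtain p where "p \<in> U" "f u \<in> R (f p)" using par by blast
    then have "f' u \<in> R' (f' p)" using f'U uU R'(2) fA by auto
    then show ?thesis using \<open>p \<in> U\<close> by blast
  qed
  ultimately have "partial_embedding ET \<rho> (insert w U) f' B R'"
    using \<rho> conn' B im c' cS R'(1) unfolding partial_embedding_def by auto
  then show ?thesis using vw(2) by blast
qed

lemma contains_induced_tree:
  assumes "V \<noteq> {}" and T: "tree VT ET" and card: "card VT \<le> n"
    and deg: "\<And>v. v \<in> VT \<Longrightarrow> degree VT ET v \<le> d"
  shows "contains_induced V E VT ET"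
proof -
  have TG: "graph VT ET" and "VT \<noteq> {}" using T unfolding tree_def by blast+
  then have finT: "finite VT" unfolding graph_def by blast
  obtain \<rho> where \<rho>: "\<rho> \<in> VT" using \<open>VT \<noteq> {}\<close> by blast
  obtain v where v: "v \<in> V" using assms(1) by blast
  have "card VT \<ge> 1" using finT \<open>VT \<noteq> {}\<close> by (simp add: Suc_le_eq card_gt_0_iff)
  then have n: "n \<ge> 1" using card by simp
  define \<U> where "\<U> = {U. U \<subseteq> VT \<and> (\<exists>f A R. partial_embedding ET \<rho> U f A R)}"
  have "finite \<U>" unfolding \<U>_def using finT by simp
  moreover have "{\<rho>} \<in> \<U>"
    unfolding \<U>_def using partial_embedding_root[OF v n TG] \<rho> by blast
  ultimately obtain U where U: "U \<in> \<U>" and max: "\<And>U'. U' \<in> \<U> \<Longrightarrow> U \<subseteq> U' \<Longrightarrow> U = U'"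
    using finite_has_maximal2[of \<U> "{\<rho>}"] by metis
  obtain f A R where pe: "partial_embedding ET \<rho> U f A R" and UT: "U \<subseteq> VT"
    using U unfolding \<U>_def by blast
  have "U = VT"
  proof (rule ccontr)
    assume "U \<noteq> VT"
    then obtain w where "w \<in> VT - U" "\<exists>f A R. partial_embedding ET \<rho> (insert w U) f A R"
      using partial_embedding_extend[OF pe T UT _ card deg] by blast
    moreover from this have "insert w U \<in> \<U>" using UT unfolding \<U>_def by blast
    ultimately show False using max[of "insert w U"] by blast
  qed
  moreover have "f ` U \<subseteq> V" using pe unfolding partial_embedding_def supported_def by blast
  ultimately show ?thesis
    using pe unfolding contains_induced_def partial_embedding_def by (intro exI[of _ f]) blast
qed

end

theorem theorem1p3:
  fixes \<Delta> n :: nat and V :: "'a set" and E :: "'a \<Rightarrow> 'a \<Rightarrow> bool"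
  assumes "\<Delta> \<ge> 1" and "n \<ge> 1"
    and "graph V E" and "V \<noteq> {}"
    and "\<forall>v\<in>V. degree V E v \<ge> 10^7 * \<Delta>"
    and "\<forall>v\<in>V. real (degree V E v) \<le> exp (real \<Delta> / 10^9)"
    and "\<forall>W F. subgraph W F V E \<and> W \<noteq> {} \<and> card W \<le> (10^7 * \<Delta> + 1) * n
              \<longrightarrow> avg_degree W F \<le> 12 / 5"
  shows "\<forall>(VT :: 'b set) ET. tree VT ET \<and> card VT = n \<and> (\<forall>v\<in>VT. degree VT ET v \<le> \<Delta>)
           \<longrightarrow> contains_induced V E VT ET"
proof -
  \<comment> \<open>Any \<open>s\<close> with \<open>s\<close> \<ge> 25,
    \<open>3 * s > 12 + 10 *\<close> \<Delta> and \<open>2 * (s + 1)\<close> \<le>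
    \<open>10^7 *\<close> \<Delta> \<open>+ 1\<close> would do; this choice leaves ample
    slack.\<close>
  define s where "s = 10^6 * \<Delta>"
  have fin: "finite V" and sym: "E u v \<Longrightarrow> u \<in> V \<and> v \<in> V \<and> E v u" for u v
    using assms(3) unfolding graph_def by blast+
  have "sparse_graph V E s \<Delta> n"
  proof
    show "graph V E" by fact
    show "s \<ge> 25" "3 * s > 12 + 10 * \<Delta>" using assms(1) unfolding s_def by simp_all
    show "2 * s \<le> card {u. E v u}" if "v \<in> V" for v
    proof -
      have "{u \<in> V. E v u} = {u. E v u}" using sym by blast
      moreover have "10^7 * \<Delta> \<le> card {u \<in> V. E v u}"
        using assms(5) that unfolding degree_def by blast
      ultimately show ?thesis unfolding s_def by simp
    qed
    show "5 * (\<Sum>w\<in>W. card {u\<in>W. E w u}) \<le> 12 * card W"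
      if W: "W \<subseteq> V" "W \<noteq> {}" "card W \<le> 2 * n * (s + 1)" for W
    proof -
      \<comment> \<open>The induced subgraph on \<open>W\<close>: edges must be restricted
        explicitly, as \<open>subgraph\<close> demands both ends in \<open>W\<close>.\<close>
      define F where "F u v \<longleftrightarrow> E u v \<and> u \<in> W \<and> v \<in> W" for u v
      have "subgraph W F V E" using W(1) sym unfolding subgraph_def F_def by blast
      moreover have "card W \<le> (10^7 * \<Delta> + 1) * n"
      proof -
        have "2 * (s + 1) \<le> 10^7 * \<Delta> + 1" using assms(1) unfolding s_def by simp
        then have "2 * (s + 1) * n \<le> (10^7 * \<Delta> + 1) * n" by (rule mult_le_mono1)
        then show ?thesis using W(3) by (simp add: ac_simps)
      qed
      ultimately have "avg_degree W F \<le> 12 / 5" using assms(7) W(2) by blast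
      moreover have "card W > 0" using W fin by (simp add: card_gt_0_iff finite_subset)
      moreover have "degree W F w = card {u\<in>W. E w u}" if "w \<in> W" for w
      proof -
        have "{u\<in>W. F w u} = {u\<in>W. E w u}" using that unfolding F_def by blast
        then show ?thesis unfolding degree_def by simp
      qed
      ultimately have "5 * (\<Sum>w\<in>W. real (card {u\<in>W. E w u})) \<le> 12 * real (card W)"
        unfolding avg_degree_def by (simp add: field_simps)
      then have "real (5 * (\<Sum>w\<in>W. card {u\<in>W. E w u})) \<le> real (12 * card W)" by simp
      then show ?thesis by (simp only: of_nat_le_iff)
    qed
  qed
  then show ?thesis using sparse_graph.contains_induced_tree assms(4) by (metis order_refl)
qed

end
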